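(* Let $a_j\in L_2(\mathbb{T})$, $j\in\mathbb{N}$, be functions with $a_j''\in L_2(\mathbb{T})$, $a_j(0)=1$, and $\sum_{j}\|a_j''\|_2/2^j<\infty$. Then for each $j$ the infinite product $$\widehat{\varphi_j}(\xi)=\prod_{r=1}^\infty a_{j+r}(\xi/2^r)$$ converges uniformly and absolutely on every interval $[a,b]\subset\mathbb{R}$. If additionally $|a_j(\xi)|^2+|a_j(\xi+1/2)|^2=1$ for all $j$ and $\xi$, then $\widehat{\varphi_j}\in L_2(\mathbb{R})$ and $\|\widehat{\varphi_j}\|_2\le1$.
   Context: $L_2(\mathbb{T})$ is the space of $1$-periodic square-integrable complex-valued functions with norm $\|f\|_2=(\int_0^1|f|^2)^{1/2}$; $\|\cdot\|_2$ on functions on $\mathbb{R}$ is the $L_2(\mathbb{R})$ norm. The derivative $a_j''$ is the (weak) second derivative of the periodic function $a_j$, i.e. $a_j''\in L_2(\mathbb{T})$ means $\sum_k|k^2\widehat{a_j}(k)|^2<\infty$ with $\widehat{a_j}(k)=\int_0^1 a_j(x)e^{-2\pi ikx}dx$; $a_j$ is identified with its continuous representative. Absolute convergence of $\prod_r p_r$ means convergence of $\sum_r|p_r-1|$. *)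

theory Defs
  imports "HOL-Analysis.Analysis"
begin

definition square_integrable :: "real measure \<Rightarrow> (real \<Rightarrow> complex) \<Rightarrow> bool" where
  "square_integrable M f \<longleftrightarrow>
     f \<in> borel_measurable M \<and> integrable M (\<lambda>x. (norm (f x))\<^sup>2)"

definition L2_norm :: "real measure \<Rightarrow> (real \<Rightarrow> complex) \<Rightarrow> real" where
  "L2_norm M f = sqrt (\<integral>x. (norm (f x))\<^sup>2 \<partial>M)"

text \<open>Functions on the circle are 1-periodic functions on the reals, integrated over one period.\<close>

abbreviation period_measure :: "real measure" where
  "period_measure \<equiv> restrict_space lborel {0..1}"

definition periodic :: "(real \<Rightarrow> complex) \<Rightarrow> bool" where
  "periodic f \<longleftrightarrow> (\<forall>x. f (x + 1) = f x)"

definition L2_circle :: "(real \<Rightarrow> complex) set" where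
  "L2_circle = {f. periodic f \<and> square_integrable period_measure f}"

definition fourier_coeff :: "(real \<Rightarrow> complex) \<Rightarrow> int \<Rightarrow> complex" where
  "fourier_coeff f k =
     (\<integral>x. f x * exp (- (2 * of_real pi * \<i> * of_int k * of_real x)) \<partial>period_measure)"

definition has_second_deriv_in_L2 :: "(real \<Rightarrow> complex) \<Rightarrow> bool" where
  "has_second_deriv_in_L2 f \<longleftrightarrow>
     (\<lambda>k::int. (norm ((of_int k)\<^sup>2 * fourier_coeff f k))\<^sup>2) summable_on UNIV"

definition vderiv :: "(real \<Rightarrow> complex) \<Rightarrow> real \<Rightarrow> complex" where
  "vderiv f = (\<lambda>x. vector_derivative f (at x))"

definition smooth_periodic :: "(real \<Rightarrow> complex) \<Rightarrow> bool" where
  "smooth_periodic \<phi> \<longleftrightarrow>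
     periodic \<phi> \<and> (\<forall>n x. (vderiv ^^ n) \<phi> differentiable (at x))"

definition is_weak_second_deriv :: "(real \<Rightarrow> complex) \<Rightarrow> (real \<Rightarrow> complex) \<Rightarrow> bool" where
  "is_weak_second_deriv f g \<longleftrightarrow>
     (\<forall>\<phi>. smooth_periodic \<phi> \<longrightarrow>
        (\<integral>x. f x * vderiv (vderiv \<phi>) x \<partial>period_measure) =
        (\<integral>x. g x * \<phi> x \<partial>period_measure))"

text \<open>
  For \<^term>\<open>f \<in> L2_circle\<close> with \<^term>\<open>has_second_deriv_in_L2 f\<close> a weak second derivative in
  \<^term>\<open>L2_circle\<close> exists by the Riesz--Fischer theorem. It is unique up to a null set, so its
  norm does not depend on the choice. Without these hypotheses the value is meaningless.
\<close>

definition weak_second_deriv :: "(real \<Rightarrow> complex) \<Rightarrow> real \<Rightarrow> complex" where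
  "weak_second_deriv f = (SOME g. g \<in> L2_circle \<and> is_weak_second_deriv f g)"

definition factor :: "(nat \<Rightarrow> real \<Rightarrow> complex) \<Rightarrow> nat \<Rightarrow> nat \<Rightarrow> real \<Rightarrow> complex" where
  "factor a j r \<xi> = a (j + r) (\<xi> / 2 ^ r)"

text \<open>The factors are indexed by \<open>r \<ge> 1\<close>, whereas \<^const>\<open>prodinf\<close> starts at 0.\<close>

definition phi_hat :: "(nat \<Rightarrow> real \<Rightarrow> complex) \<Rightarrow> nat \<Rightarrow> real \<Rightarrow> complex" where
  "phi_hat a j \<xi> = (\<Prod>r. factor a j (Suc r) \<xi>)"

end

theory Submission imports Defs begin

text \<open>
  Write \<open>c\<^sub>k\<close> for the Fourier coefficients of \<open>f = a\<^sub>j\<close>. Since \<open>f''\<close> has coefficients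
  \<open>(2\<pi>ik)\<^sup>2 c\<^sub>k\<close>, the inequalities of Cauchy-Schwarz and Bessel bound \<open>\<Sum> |2\<pi>k c\<^sub>k|\<close> by a constant
  times \<open>\<parallel>f''\<parallel>\<^sub>2\<close>. As a continuous function is determined by its coefficients, \<open>f\<close> is the sum of its
  Fourier series, hence \<open>|f(x) - f(0)| \<le> C |x| \<parallel>f''\<parallel>\<^sub>2\<close>. On a bounded interval the
  \<open>r\<close>-th factor therefore differs from 1 by at most a constant times \<open>\<parallel>a\<^sub>j\<^sub>+\<^sub>r''\<parallel>\<^sub>2 / 2\<^sup>r\<close>, and the
  Weierstrass test applies.

  For the norm bound, let \<open>P\<^sub>n\<close> be the squared modulus of the \<open>n\<close>-th partial product, which has
  period \<open>2\<^sup>n\<close>. The mirror condition says \<open>P\<^sub>n\<^sub>+\<^sub>1(\<xi>) + P\<^sub>n\<^sub>+\<^sub>1(\<xi> + 2\<^sup>n) = P\<^sub>n(\<xi>)\<close>, so the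
  integral of \<open>P\<^sub>n\<close> over a period is 1 for every \<open>n\<close>, and Fatou's lemma gives the claim.
\<close>

section \<open>Characters of the circle\<close>

definition echar :: "int \<Rightarrow> real \<Rightarrow> complex" where
  "echar k x = exp (2 * of_real pi * \<i> * of_int k * of_real x)"

lemma echar_0 [simp]: "echar 0 x = 1"
  by (simp add: echar_def)

lemma echar_at_0 [simp]: "echar k 0 = 1"
  by (simp add: echar_def)

lemma echar_add: "echar (k + l) x = echar k x * echar l x"
  by (simp add: echar_def algebra_simps flip: exp_add)

lemma echar_cis: "echar k x = cis (2 * pi * k * x)"
  by (simp add: echar_def cis_conv_exp mult_ac)

lemma norm_echar [simp]: "norm (echar k x) = 1"
  by (simp add: echar_cis)

lemma cnj_echar: "cnj (echar k x) = echar (- k) x"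
  by (simp add: echar_cis cis_cnj)

lemma echar_periodic: "echar k (x + 1) = echar k x"
proof -
  have "echar k (x + 1) = echar k x * cis (2 * pi * k)"
    by (simp add: echar_cis cis_mult algebra_simps)
  also have "cis (2 * pi * k) = 1"
    by (metis cis_multiple_2pi Ints_of_int)
  finally show ?thesis by simp
qed

lemma continuous_on_echar [continuous_intros]:
  "continuous_on A f \<Longrightarrow> continuous_on A (\<lambda>x. echar k (f x))"
  unfolding echar_def by (intro continuous_intros)

lemma echar_has_vector_derivative:
  "((\<lambda>x. c * echar k x) has_vector_derivative (2 * of_real pi * \<i> * of_int k * c * echar k x)) (at x within A)"
proof -
  let ?w = "2 * of_real pi * \<i> * of_int k :: complex"
  have "((\<lambda>z. c * exp (?w * z)) has_field_derivative (?w * c * exp (?w * of_real x))) (at (of_real x))"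
    by (auto intro!: derivative_eq_intros)
  from has_vector_derivative_real_field[OF this] show ?thesis
    by (simp add: echar_def)
qed

lemma fourier_coeff_echar: "fourier_coeff f k = (\<integral>x. f x * echar (- k) x \<partial>period_measure)"
  by (simp add: fourier_coeff_def echar_def)

text \<open>The chord from 1 to \<open>cis t\<close> has length
  \<open>2 * \<bar>sin (t / 2)\<bar>\<close>, and the sine is at most its argument in modulus. This
  is the source of the factor \<open>\<bar>x\<bar>\<close> in the bound on
  \<open>f x - f 0\<close>.\<close>

lemma norm_echar_diff_le: "norm (echar k x - 1) \<le> 2 * pi * \<bar>real_of_int k\<bar> * \<bar>x\<bar>"
proof -
  have "norm (echar k x - 1) \<le> \<bar>2 * pi * k * x\<bar>"
    using dist_exp_i_1[of "2 * pi * k * x"] abs_sin_x_le_abs_x[of "2 * pi * k * x / 2"]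
    by (simp add: echar_cis cis_conv_exp)
  thus ?thesis by (simp add: abs_mult)
qed

subsection \<open>Square-integrable functions on one period\<close>

lemma space_period_measure [simp]: "space period_measure = {0..1}"
  by (simp add: space_restrict_space)

lemma measurable_period:
  "f \<in> borel_measurable borel \<Longrightarrow> f \<in> borel_measurable period_measure"
  by (simp add: measurable_restrict_space1)

lemma finite_period_measure: "finite_measure period_measure"
  by (rule finite_measureI) (simp add: emeasure_restrict_space)

interpretation period: finite_measure period_measure
  by (rule finite_period_measure)

lemma measure_period [simp]: "measure period_measure {0..1} = 1"
  by (simp add: measure_restrict_space)

lemma integrable_period_continuous:
  fixes f :: "real \<Rightarrow> 'b::euclidean_space"
  assumes "continuous_on UNIV f"
  shows "integrable period_measure f"
proof (subst integrable_restrict_space)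
  show "integrable lborel (\<lambda>x. indicator {0..1} x *\<^sub>R f x)"
    by (rule borel_integrable_compact) (auto intro: continuous_on_subset[OF assms])
qed simp

lemma integral_period_FTC:
  fixes F f :: "real \<Rightarrow> 'b::euclidean_space"
  assumes "\<And>x. (F has_vector_derivative f x) (at x)" "continuous_on UNIV f"
  shows "(\<integral>x. f x \<partial>period_measure) = F 1 - F 0"
proof (subst integral_restrict_space)
  show "(\<integral>x. indicator {0..1} x *\<^sub>R f x \<partial>lborel) = F 1 - F 0"
    by (rule integral_FTC_atLeastAtMost)
       (auto intro: assms has_vector_derivative_at_within continuous_on_subset[OF assms(2)])
qed simp

lemma integral_echar: "(\<integral>x. echar k x \<partial>period_measure) = (if k = 0 then 1 else 0)"
proof (cases "k = 0")
  case False
  let ?w = "2 * of_real pi * \<i> * of_int k :: complex"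
  have "?w \<noteq> 0" using False by simp
  then have "\<And>x. ((\<lambda>x. (1 / ?w) * echar k x) has_vector_derivative echar k x) (at x)"
    using echar_has_vector_derivative[of "1 / ?w" k] by simp
  from integral_period_FTC[OF this] show ?thesis
    using False echar_periodic[of k 0] by (simp add: continuous_on_echar)
qed simp

lemma integrable_norm_sq: "square_integrable M f \<Longrightarrow> integrable M (\<lambda>x. (norm (f x))\<^sup>2)"
  by (simp add: square_integrable_def)

lemma square_integrable_imp_integrable:
  assumes "square_integrable period_measure f"
  shows "integrable period_measure f"
proof (rule Bochner_Integration.integrable_bound)
  show "integrable period_measure (\<lambda>x. 1 + (norm (f x))\<^sup>2)"
    using assms by (simp add: square_integrable_def)
  have "t \<le> 1 + t\<^sup>2" for t :: real
    using zero_le_power2[of "t - 1/2"] by (simp add: power2_eq_square algebra_simps)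
  then show "AE x in period_measure. norm (f x) \<le> norm (1 + (norm (f x))\<^sup>2)"
    by (intro AE_I2) (metis abs_of_nonneg add_nonneg_nonneg real_norm_def zero_le_one zero_le_power2)
qed (use assms in \<open>simp add: square_integrable_def\<close>)

lemma square_integrable_continuous:
  "continuous_on UNIV f \<Longrightarrow> square_integrable period_measure f"
  unfolding square_integrable_def
  by (intro conjI integrable_period_continuous continuous_intros measurable_period borel_measurable_continuous_onI)

lemma square_integrable_mult:
  assumes "square_integrable M f" "square_integrable M g"
  shows "integrable M (\<lambda>x. f x * g x)"
proof (rule Bochner_Integration.integrable_bound)
  show "integrable M (\<lambda>x. (norm (f x))\<^sup>2 + (norm (g x))\<^sup>2)"
    using assms by (simp add: square_integrable_def)
  have "s * t \<le> s\<^sup>2 + t\<^sup>2" if "s \<ge> 0" "t \<ge> 0" for s t :: real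
    using sum_squares_bound[of s t] mult_nonneg_nonneg[OF that] by linarith
  then show "AE x in M. norm (f x * g x) \<le> norm ((norm (f x))\<^sup>2 + (norm (g x))\<^sup>2)"
    by (intro AE_I2) (simp add: norm_mult)
qed (use assms in \<open>simp add: square_integrable_def borel_measurable_times\<close>)

lemma square_integrable_add:
  assumes "square_integrable M f" "square_integrable M g"
  shows "square_integrable M (\<lambda>x. f x + g x)"
proof -
  have "integrable M (\<lambda>x. (norm (f x + g x))\<^sup>2)"
  proof (rule Bochner_Integration.integrable_bound)
    show "integrable M (\<lambda>x. 2 * (norm (f x))\<^sup>2 + 2 * (norm (g x))\<^sup>2)"
      using assms by (simp add: square_integrable_def)
    have "(s + t)\<^sup>2 \<le> 2 * s\<^sup>2 + 2 * t\<^sup>2" for s t :: real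
      using zero_le_power2[of "s - t"] by (simp add: power2_eq_square algebra_simps)
    then have "(norm (f x + g x))\<^sup>2 \<le> 2 * (norm (f x))\<^sup>2 + 2 * (norm (g x))\<^sup>2" for x
      using power_mono[OF norm_triangle_ineq norm_ge_zero] order_trans by blast
    then show "AE x in M. norm ((norm (f x + g x))\<^sup>2) \<le> norm (2 * (norm (f x))\<^sup>2 + 2 * (norm (g x))\<^sup>2)"
      by (intro AE_I2) simp
  qed (use assms in \<open>auto simp: square_integrable_def intro!: borel_measurable_power borel_measurable_norm borel_measurable_add\<close>)
  then show ?thesis
    using assms by (auto simp: square_integrable_def)
qed

text \<open>Nonnegativity of a variance: the period has mass 1, so with \<open>c\<close> the mean of
  \<open>norm (f x)\<close> the integral of \<open>(norm (f x) - c)\<^sup>2\<close> is the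
  right-hand side minus \<open>c\<^sup>2\<close>.\<close>

lemma integral_norm_squared_le:
  fixes f :: "real \<Rightarrow> complex"
  assumes "square_integrable period_measure f"
  shows "(\<integral>x. norm (f x) \<partial>period_measure)\<^sup>2 \<le> (\<integral>x. (norm (f x))\<^sup>2 \<partial>period_measure)"
proof -
  define c where "c = (\<integral>x. norm (f x) \<partial>period_measure)"
  have I: "integrable period_measure (\<lambda>x. norm (f x))"
    using square_integrable_imp_integrable[OF assms] by simp
  have "0 \<le> (\<integral>x. (norm (f x) - c)\<^sup>2 \<partial>period_measure)"
    by simp
  also have "\<dots> = (\<integral>x. (norm (f x))\<^sup>2 - 2 * c * norm (f x) + c\<^sup>2 \<partial>period_measure)"
    by (simp add: power2_diff mult_ac algebra_simps)
  also have "\<dots> = (\<integral>x. (norm (f x))\<^sup>2 \<partial>period_measure) - 2 * c * c + c\<^sup>2"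
    using I integrable_norm_sq[OF assms] by (simp add: c_def)
  finally show ?thesis by (simp add: c_def power2_eq_square)
qed

section \<open>Orthonormality of the characters and Bessel's inequality\<close>

lemma integral_echar_mult:
  "(\<integral>x. echar k x * echar (- l) x \<partial>period_measure) = (if k = l then 1 else 0)"
  using integral_echar[of "k - l"] by (simp flip: echar_add)

lemma fourier_coeff_trig_sum:
  assumes "finite K"
  shows "fourier_coeff (\<lambda>x. \<Sum>k\<in>K. c k * echar k x) l = (if l \<in> K then c l else 0)"
proof -
  have "fourier_coeff (\<lambda>x. \<Sum>k\<in>K. c k * echar k x) l
      = (\<integral>x. (\<Sum>k\<in>K. c k * (echar k x * echar (- l) x)) \<partial>period_measure)"
    by (simp add: fourier_coeff_echar sum_distrib_right mult.assoc)
  also have "\<dots> = (\<Sum>k\<in>K. c k * (if k = l then 1 else 0))"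
    by (subst Bochner_Integration.integral_sum)
       (auto simp: integral_echar_mult intro!: integrable_period_continuous continuous_intros sum.cong)
  also have "\<dots> = (if l \<in> K then c l else 0)"
    using assms by (simp add: if_distrib cong: if_cong)
  finally show ?thesis .
qed

lemma integral_mult_cnj_trig_sum:
  assumes "square_integrable period_measure g" "finite K"
  shows "(\<integral>x. g x * cnj (\<Sum>k\<in>K. c k * echar k x) \<partial>period_measure)
       = (\<Sum>k\<in>K. cnj (c k) * fourier_coeff g k)"
proof -
  have I: "integrable period_measure (\<lambda>x. cnj (c k) * (g x * echar (- k) x))" for k
    by (intro integrable_mult_right square_integrable_mult assms square_integrable_continuous continuous_intros)
  have "(\<integral>x. g x * cnj (\<Sum>k\<in>K. c k * echar k x) \<partial>period_measure)
      = (\<integral>x. (\<Sum>k\<in>K. cnj (c k) * (g x * echar (- k) x)) \<partial>period_measure)"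
    by (simp add: sum_distrib_left cnj_echar mult_ac)
  also have "\<dots> = (\<Sum>k\<in>K. cnj (c k) * fourier_coeff g k)"
    by (subst Bochner_Integration.integral_sum) (use I in \<open>simp_all add: fourier_coeff_echar\<close>)
  finally show ?thesis .
qed

lemma integral_norm_squared_trig_sum:
  assumes "finite K"
  shows "(\<integral>x. (norm (\<Sum>k\<in>K. c k * echar k x))\<^sup>2 \<partial>period_measure) = (\<Sum>k\<in>K. (norm (c k))\<^sup>2)"
proof -
  let ?p = "\<lambda>x. \<Sum>k\<in>K. c k * echar k x"
  have "complex_of_real (\<integral>x. (norm (?p x))\<^sup>2 \<partial>period_measure)
      = (\<integral>x. ?p x * cnj (?p x) \<partial>period_measure)"
    by (simp only: complex_norm_square flip: integral_complex_of_real)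
  also have "\<dots> = (\<Sum>k\<in>K. cnj (c k) * fourier_coeff ?p k)"
    by (intro integral_mult_cnj_trig_sum square_integrable_continuous continuous_intros assms)
  also have "\<dots> = complex_of_real (\<Sum>k\<in>K. (norm (c k))\<^sup>2)"
    by (simp add: fourier_coeff_trig_sum[OF assms] complex_norm_square mult.commute del: of_real_power)
  finally show ?thesis
    using of_real_eq_iff by blast
qed

text \<open>Expand the squared distance from \<open>g\<close> to its partial Fourier sum
  \<open>?p\<close>. By orthonormality both the inner product of \<open>g\<close> with
  \<open>?p\<close> and the squared norm of \<open>?p\<close> equal the sum on the left, so the
  distance is the right-hand side minus the left-hand side.\<close>

lemma Bessel_inequality:
  assumes g: "square_integrable period_measure g" and K: "finite K"
  shows "(\<Sum>k\<in>K. (norm (fourier_coeff g k))\<^sup>2) \<le> (\<integral>x. (norm (g x))\<^sup>2 \<partial>period_measure)"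
proof -
  let ?c = "fourier_coeff g"
  let ?p = "\<lambda>x. \<Sum>k\<in>K. ?c k * echar k x"
  have p: "square_integrable period_measure ?p"
    by (intro square_integrable_continuous continuous_intros)
  have I: "integrable period_measure (\<lambda>x. Re (g x * cnj (?p x)))"
    by (intro integrable_Re square_integrable_mult[OF g] square_integrable_continuous continuous_intros)
  have expand: "(norm (z - w))\<^sup>2 = (norm z)\<^sup>2 - 2 * Re (z * cnj w) + (norm w)\<^sup>2" for z w
    by (simp add: cmod_power2 power2_diff algebra_simps)
  have "0 \<le> (\<integral>x. (norm (g x - ?p x))\<^sup>2 \<partial>period_measure)"
    by simp
  also have "\<dots> = (\<integral>x. (norm (g x))\<^sup>2 - 2 * Re (g x * cnj (?p x)) + (norm (?p x))\<^sup>2 \<partial>period_measure)"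
    by (simp only: expand)
  also have "\<dots> = (\<integral>x. (norm (g x))\<^sup>2 \<partial>period_measure)
      - 2 * (\<integral>x. Re (g x * cnj (?p x)) \<partial>period_measure) + (\<integral>x. (norm (?p x))\<^sup>2 \<partial>period_measure)"
    using I integrable_norm_sq[OF g] integrable_norm_sq[OF p]
    by (simp del: Re_sum Im_sum times_complex.simps cnj_sum complex_cnj_mult)
  also have "(\<integral>x. Re (g x * cnj (?p x)) \<partial>period_measure)
      = Re (\<integral>x. g x * cnj (?p x) \<partial>period_measure)"
    by (intro integral_Re square_integrable_mult[OF g] square_integrable_continuous continuous_intros)
  also have "(\<integral>x. g x * cnj (?p x) \<partial>period_measure) = of_real (\<Sum>k\<in>K. (norm (?c k))\<^sup>2)"
    by (subst integral_mult_cnj_trig_sum[OF g K]) (simp add: complex_norm_square mult.commute del: of_real_power)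
  finally show ?thesis
    by (simp add: integral_norm_squared_trig_sum[OF K])
qed

subsection \<open>Uniqueness of Fourier coefficients\<close>

text \<open>With monomials and sums as the only rules, orthogonality to all trigonometric
  polynomials becomes an induction with two cases. Closure under products is derived below; it lets
  polynomials in the real and imaginary parts of \<open>echar 1 x\<close> count as trigonometric
  polynomials.\<close>

inductive trig_poly :: "(real \<Rightarrow> complex) \<Rightarrow> bool" where
  trig_poly_echar: "trig_poly (\<lambda>x. c * echar k x)"
| trig_poly_add: "trig_poly f \<Longrightarrow> trig_poly g \<Longrightarrow> trig_poly (\<lambda>x. f x + g x)"

lemma trig_poly_const: "trig_poly (\<lambda>x. c)"
  using trig_poly_echar[of c 0] by simp

lemma trig_poly_mult_echar: "trig_poly f \<Longrightarrow> trig_poly (\<lambda>x. f x * (c * echar k x))"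
proof (induction rule: trig_poly.induct)
  case (trig_poly_echar d l)
  show ?case
    using trig_poly.trig_poly_echar[of "d * c" "l + k"] by (simp add: echar_add mult_ac)
next
  case (trig_poly_add f g)
  then show ?case
    using trig_poly.trig_poly_add by (simp add: distrib_right)
qed

lemma trig_poly_mult: "trig_poly g \<Longrightarrow> trig_poly f \<Longrightarrow> trig_poly (\<lambda>x. f x * g x)"
  by (induction rule: trig_poly.induct)
     (auto intro: trig_poly_mult_echar trig_poly_add simp: distrib_left)

lemma trig_poly_real_polynomial:
  "real_polynomial_function p \<Longrightarrow> trig_poly (\<lambda>x. of_real (p (echar 1 x)))"
proof (induction rule: real_polynomial_function.induct)
  case (linear f)
  then interpret bounded_linear f .
  have f: "f z = Re z * f 1 + Im z * f \<i>" for z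
  proof -
    have "z = Re z *\<^sub>R 1 + Im z *\<^sub>R \<i>" by (simp add: complex_eq_iff)
    then have "f z = f (Re z *\<^sub>R 1 + Im z *\<^sub>R \<i>)" by (rule arg_cong)
    then show ?thesis by (simp add: add scaleR)
  qed
  \<comment> \<open>On the unit circle the conjugate of \<open>z\<close> is \<open>1 / z\<close>, so
    \<open>Re z = (z + 1 / z) / 2\<close> and \<open>Im z = (z - 1 / z) / (2 * \<i>)\<close>.
    Collecting the coefficients of \<open>z\<close> and \<open>1 / z\<close> gives \<open>?c\<close>
    and \<open>?d\<close>.\<close>
  let ?c = "of_real (f 1) / 2 + of_real (f \<i>) / (2 * \<i>)" and ?d = "of_real (f 1) / 2 - of_real (f \<i>) / (2 * \<i>)"
  have "(\<lambda>x. of_real (f (echar 1 x))) = (\<lambda>x. ?c * echar 1 x + ?d * echar (- 1) x)"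
    by (rule ext, subst f) (simp add: complex_eq_iff cnj_echar[of 1, symmetric, simplified] field_simps)
  then show ?case
    by (simp only:) (intro trig_poly_add trig_poly_echar)
qed (auto intro: trig_poly_const trig_poly_add trig_poly_mult)

lemma trig_poly_polynomial_function:
  assumes "polynomial_function p"
  shows "trig_poly (\<lambda>x. p (echar 1 x))"
proof -
  have "real_polynomial_function (\<lambda>z. Re (p z))" "real_polynomial_function (\<lambda>z. Im (p z))"
    using assms bounded_linear_Re bounded_linear_Im by (auto simp: polynomial_function_def o_def)
  then have "trig_poly (\<lambda>x. of_real (Re (p (echar 1 x))) + \<i> * of_real (Im (p (echar 1 x))))"
    by (intro trig_poly_add trig_poly_mult trig_poly_const trig_poly_real_polynomial)
  then show ?thesis
    by (simp flip: complex_eq)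
qed

lemma periodic_add_int:
  assumes "periodic f"
  shows "f (x + of_int k) = f x"
proof (induction k arbitrary: x rule: int_induct[where k = 0])
  case (step1 i)
  have "f (x + of_int (i + 1)) = f ((x + of_int i) + 1)" by (simp add: add_ac)
  with step1 assms show ?case by (simp add: periodic_def)
next
  case (step2 i)
  have "f (x + of_int (i - 1)) = f ((x + of_int (i - 1)) + 1)"
    using assms unfolding periodic_def by metis
  also have "\<dots> = f (x + of_int i)" by (simp add: add_ac)
  finally show ?case using step2 by simp
qed simp

text \<open>Moves a periodic function to a compact set, where the Stone-Weierstrass theorem applies.
  \<open>F\<close> is defined through \<open>Arg\<close>, which jumps across the negative real axis.
  Since \<open>f\<close> is periodic, \<open>Arg2pi\<close> yields the same values on the circle,
  and it is continuous off the nonnegative axis; so one of the two branches proves continuity at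
  each point.\<close>

lemma periodic_factor_through_circle:
  assumes "continuous_on UNIV f" "periodic f"
  obtains F where "continuous_on (sphere 0 1) F" "\<And>x. F (echar 1 x) = f x"
proof
  define F where "F z = f (Arg z / (2 * pi))" for z
  show eq: "F (echar 1 x) = f x" for x
  proof -
    have "cis (Arg (echar 1 x)) = cis (2 * pi * x)"
      using cis_Arg[of "echar 1 x"] by (simp add: echar_cis sgn_div_norm)
    then obtain n :: int where "Arg (echar 1 x) = 2 * pi * x + 2 * pi * n"
      using sin_cos_eq_iff[of "Arg (echar 1 x)" "2 * pi * x"] by (auto simp: complex_eq_iff)
    then have "Arg (echar 1 x) / (2 * pi) = x + of_int n" by (simp add: field_simps)
    then show ?thesis by (simp add: F_def periodic_add_int[OF assms(2)])
  qed
  have f: "isCont f x" for x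
    using assms(1) by (simp add: continuous_on_eq_continuous_at)
  have F2: "F z = f (Arg2pi z / (2 * pi))" if "norm z = 1" for z
  proof -
    have "echar 1 (Arg2pi z / (2 * pi)) = z"
      using Arg2pi_eq[of z] that by (auto simp: echar_cis cis_conv_exp)
    then show ?thesis using eq by metis
  qed
  show "continuous_on (sphere 0 1) F"
  proof (subst continuous_on_eq_continuous_within, intro ballI)
    fix z :: complex assume z: "z \<in> sphere 0 1"
    show "continuous (at z within sphere 0 1) F"
    proof (cases "z \<in> \<real>\<^sub>\<le>\<^sub>0")
      case False
      then have "isCont F z" unfolding F_def
        by (intro isCont_o2[OF _ f] continuous_intros continuous_at_Arg) auto
      then show ?thesis by (rule continuous_at_imp_continuous_within)
    next
      case True
      with z have "z \<notin> \<real>\<^sub>\<ge>\<^sub>0" by (auto elim!: nonpos_Reals_cases nonneg_Reals_cases)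
      then have "isCont (\<lambda>z. f (Arg2pi z / (2 * pi))) z"
        by (intro isCont_o2[OF _ f] continuous_intros continuous_at_Arg2pi) auto
      then have "continuous (at z within sphere 0 1) (\<lambda>z. f (Arg2pi z / (2 * pi)))"
        by (rule continuous_at_imp_continuous_within)
      then show ?thesis
        by (rule continuous_transform_within[of _ _ _ 1]) (use z F2 in auto)
    qed
  qed
qed

text \<open>Such an \<open>f\<close> is orthogonal to every trigonometric polynomial. Replacing the
  conjugate of \<open>f\<close> by a uniform approximation of error \<open>e\<close> bounds the
  integral of the squared modulus by \<open>e\<close> times that of the modulus. With
  \<open>e\<close> arbitrary the squared norm is 0, and continuity makes \<open>f\<close> vanish
  everywhere.\<close>

lemma continuous_periodic_eq_0:
  assumes cont: "continuous_on UNIV f" and per: "periodic f"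
    and zero: "\<And>k. fourier_coeff f k = 0"
  shows "f x = 0"
proof -
  have f2: "square_integrable period_measure f"
    by (intro square_integrable_continuous cont)
  \<comment> \<open>Square-integrability is carried along in the induction because the sum case has
    to split an integral.\<close>
  have orth: "(\<integral>x. f x * p x \<partial>period_measure) = 0 \<and> square_integrable period_measure p"
    if "trig_poly p" for p
    using that
  proof induction
    case (trig_poly_echar c k)
    have "(\<integral>x. f x * (c * echar k x) \<partial>period_measure) = c * fourier_coeff f (- k)"
      by (simp add: fourier_coeff_echar mult.left_commute)
    then show ?case
      using zero by (auto intro!: square_integrable_continuous continuous_intros)
  next
    case (trig_poly_add p q)
    then show ?case
      using square_integrable_mult[OF f2] by (auto simp: distrib_left intro: square_integrable_add)
  qed
  obtain F where F: "continuous_on (sphere 0 1) F" "\<And>x. F (echar 1 x) = f x"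
    using periodic_factor_through_circle[OF cont per] by blast
  define A where "A = (\<integral>x. norm (f x) \<partial>period_measure)"
  have A: "A \<ge> 0" by (simp add: A_def)
  have small: "(\<integral>x. (norm (f x))\<^sup>2 \<partial>period_measure) \<le> e * A" if e: "e > 0" for e
  proof -
    obtain p where p: "polynomial_function p" "\<And>z. z \<in> sphere 0 1 \<Longrightarrow> norm (cnj (F z) - p z) < e"
      using Stone_Weierstrass_polynomial_function[OF compact_sphere _ e, of 0 1 "\<lambda>z. cnj (F z)"] F(1)
      by (auto intro: continuous_intros)
    let ?p = "\<lambda>x. p (echar 1 x)"
    note p' = orth[OF trig_poly_polynomial_function[OF p(1)]]
    have fp: "integrable period_measure (\<lambda>x. f x * ?p x)"
      using f2 p' by (intro square_integrable_mult) auto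
    have ff: "integrable period_measure (\<lambda>x. f x * cnj (f x))"
      using f2 cont by (intro square_integrable_mult square_integrable_continuous continuous_intros)
    have "complex_of_real (\<integral>x. (norm (f x))\<^sup>2 \<partial>period_measure) = (\<integral>x. f x * cnj (f x) \<partial>period_measure)"
      by (simp only: complex_norm_square flip: integral_complex_of_real)
    also have "\<dots> = (\<integral>x. f x * (cnj (f x) - ?p x) \<partial>period_measure)"
      using p' fp ff by (simp add: right_diff_distrib)
    finally have "norm (complex_of_real (\<integral>x. (norm (f x))\<^sup>2 \<partial>period_measure))
        = norm (\<integral>x. f x * (cnj (f x) - ?p x) \<partial>period_measure)" by simp
    also have "\<dots> \<le> (\<integral>x. e * norm (f x) \<partial>period_measure)"
    proof (rule Bochner_Integration.integral_norm_bound_integral)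
      show "integrable period_measure (\<lambda>x. f x * (cnj (f x) - ?p x))"
        using fp ff by (simp add: right_diff_distrib)
      show "integrable period_measure (\<lambda>x. e * norm (f x))"
        using square_integrable_imp_integrable[OF f2] by simp
      show "norm (f x * (cnj (f x) - ?p x)) \<le> e * norm (f x)" for x
        using p(2)[of "echar 1 x"] by (simp add: F(2) norm_mult mult.commute[of e] mult_left_mono)
    qed
    finally show ?thesis by (simp add: A_def)
  qed
  have int0: "(\<integral>x. (norm (f x))\<^sup>2 \<partial>period_measure) \<le> 0"
  proof (rule field_le_epsilon)
    fix e :: real assume "e > 0"
    \<comment> \<open>Dividing by \<open>A + 1\<close> instead of \<open>A\<close> covers the case
      \<open>A = 0\<close>.\<close>
    then have "(\<integral>x. (norm (f x))\<^sup>2 \<partial>period_measure) \<le> e / (A + 1) * A"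
      using A by (intro small) simp
    also have "\<dots> \<le> 0 + e" using A \<open>e > 0\<close> by (simp add: field_simps)
    finally show "(\<integral>x. (norm (f x))\<^sup>2 \<partial>period_measure) \<le> 0 + e" .
  qed
  have cont2: "continuous_on UNIV (\<lambda>x. (norm (f x))\<^sup>2)"
    by (intro continuous_intros cont)
  have "integral {0..1} (\<lambda>x. (norm (f x))\<^sup>2) = 0"
  proof -
    have "(\<integral>x. (norm (f x))\<^sup>2 \<partial>period_measure) = (LINT x:{0..1}|lborel. (norm (f x))\<^sup>2)"
      by (simp add: integral_restrict_space set_lebesgue_integral_def)
    also have "\<dots> = integral {0..1} (\<lambda>x. (norm (f x))\<^sup>2)"
      by (rule set_borel_integral_eq_integral(2), rule borel_integrable_atLeastAtMost',
          rule continuous_on_subset[OF cont2 subset_UNIV])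
    finally show ?thesis
      using int0 Bochner_Integration.integral_nonneg[of period_measure "\<lambda>x. (norm (f x))\<^sup>2"] by simp
  qed
  then have f01: "f x = 0" if "x \<in> {0..1}" for x
    using integral_eq_0_iff[OF continuous_on_subset[OF cont2 subset_UNIV], of 0 1] that by simp
  have "f x = f (frac x + of_int \<lfloor>x\<rfloor>)" by (simp add: frac_def)
  also have "\<dots> = f (frac x)" by (rule periodic_add_int[OF per])
  finally show ?thesis
    using f01[of "frac x"] by (simp add: frac_ge_0 frac_lt_1 less_imp_le)
qed

subsection \<open>Fourier series and weak second derivatives\<close>

text \<open>The filter is left general: limits are taken along finite sets of frequencies when
  coefficients are compared, and along symmetric partial sums for the weak derivative.\<close>

lemma tendsto_integral_period_uniform:
  fixes u :: "'i \<Rightarrow> real \<Rightarrow> complex"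
  assumes lim: "uniform_limit {0..1} u f F"
    and cont: "\<And>n. continuous_on UNIV (u n)" "continuous_on UNIV f" "continuous_on UNIV \<psi>"
  shows "((\<lambda>n. \<integral>x. u n x * \<psi> x \<partial>period_measure) \<longlongrightarrow> (\<integral>x. f x * \<psi> x \<partial>period_measure)) F"
proof (rule tendstoI)
  fix e :: real assume e: "e > 0"
  obtain B where B: "B > 0" "\<And>x. x \<in> {0..1} \<Longrightarrow> norm (\<psi> x) \<le> B"
    using compact_imp_bounded[OF compact_continuous_image[OF continuous_on_subset[OF cont(3)] compact_Icc[of 0 1]]]
    unfolding bounded_pos by auto
  have "\<forall>\<^sub>F n in F. \<forall>x\<in>{0..1}. dist (u n x) (f x) < e / (2 * B)"
    using lim e B by (intro uniform_limitD) auto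
  then show "\<forall>\<^sub>F n in F. dist (\<integral>x. u n x * \<psi> x \<partial>period_measure) (\<integral>x. f x * \<psi> x \<partial>period_measure) < e"
  proof eventually_elim
    case (elim n)
    have "dist (\<integral>x. u n x * \<psi> x \<partial>period_measure) (\<integral>x. f x * \<psi> x \<partial>period_measure)
        = norm (\<integral>x. (u n x - f x) * \<psi> x \<partial>period_measure)"
      unfolding dist_norm left_diff_distrib
      by (subst Bochner_Integration.integral_diff)
         (intro integrable_period_continuous continuous_intros cont refl)+
    also have "\<dots> \<le> (\<integral>x. e / 2 \<partial>period_measure)"
    proof (rule Bochner_Integration.integral_norm_bound_integral)
      show "integrable period_measure (\<lambda>x. (u n x - f x) * \<psi> x)"
        by (intro integrable_period_continuous continuous_intros cont)
      fix x assume "x \<in> space period_measure"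
      then have x: "x \<in> {0..1}" by simp
      then have "norm (u n x - f x) * norm (\<psi> x) \<le> e / (2 * B) * B"
        using elim B(2)[OF x] e B(1) by (intro mult_mono) (auto simp: dist_norm less_imp_le)
      then show "norm ((u n x - f x) * \<psi> x) \<le> e / 2"
        using B(1) by (simp add: norm_mult)
    qed simp
    finally show ?case using e by simp
  qed
qed

text \<open>The difference is at most the supremum of \<open>\<psi>\<close> times an
  \<open>L1\<close> distance, and on a space of mass 1 the \<open>L2\<close> distance dominates the
  latter.\<close>

lemma tendsto_integral_period_L2:
  fixes u :: "nat \<Rightarrow> real \<Rightarrow> complex"
  assumes lim: "(\<lambda>n. \<integral>x. (norm (g x - u n x))\<^sup>2 \<partial>period_measure) \<longlonglongrightarrow> 0"
    and cont: "\<And>n. continuous_on UNIV (u n)" "continuous_on UNIV \<psi>"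
    and g: "square_integrable period_measure g"
  shows "(\<lambda>n. \<integral>x. u n x * \<psi> x \<partial>period_measure) \<longlonglongrightarrow> (\<integral>x. g x * \<psi> x \<partial>period_measure)"
proof -
  obtain B where B: "B > 0" "\<And>x. x \<in> {0..1} \<Longrightarrow> norm (\<psi> x) \<le> B"
    using compact_imp_bounded[OF compact_continuous_image[OF continuous_on_subset[OF cont(2)] compact_Icc[of 0 1]]]
    unfolding bounded_pos by auto
  have gu: "square_integrable period_measure (\<lambda>x. g x - u n x)" for n
    using square_integrable_add[OF g square_integrable_continuous[of "\<lambda>x. - u n x"]] cont(1)
    by (simp add: continuous_on_minus)
  have bound: "norm ((\<integral>x. u n x * \<psi> x \<partial>period_measure) - (\<integral>x. g x * \<psi> x \<partial>period_measure))
      \<le> B * sqrt (\<integral>x. (norm (g x - u n x))\<^sup>2 \<partial>period_measure)" for n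
  proof -
    have "norm ((\<integral>x. u n x * \<psi> x \<partial>period_measure) - (\<integral>x. g x * \<psi> x \<partial>period_measure))
        = norm (\<integral>x. (g x - u n x) * \<psi> x \<partial>period_measure)"
      unfolding left_diff_distrib
      by (subst Bochner_Integration.integral_diff)
         (auto simp: norm_minus_commute intro!: square_integrable_mult g square_integrable_continuous cont)
    also have "\<dots> \<le> (\<integral>x. B * norm (g x - u n x) \<partial>period_measure)"
    proof (rule Bochner_Integration.integral_norm_bound_integral)
      show "integrable period_measure (\<lambda>x. (g x - u n x) * \<psi> x)"
        by (intro square_integrable_mult gu square_integrable_continuous cont)
      show "integrable period_measure (\<lambda>x. B * norm (g x - u n x))"
        using square_integrable_imp_integrable[OF gu] by simp
      show "norm ((g x - u n x) * \<psi> x) \<le> B * norm (g x - u n x)" if "x \<in> space period_measure" for x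
        using B(2)[of x] that by (simp add: norm_mult mult.commute[of B] mult_left_mono)
    qed
    also have "\<dots> \<le> B * sqrt (\<integral>x. (norm (g x - u n x))\<^sup>2 \<partial>period_measure)"
      using B(1) integral_norm_squared_le[OF gu] by (simp add: real_le_rsqrt)
    finally show ?thesis .
  qed
  have "(\<lambda>n. B * sqrt (\<integral>x. (norm (g x - u n x))\<^sup>2 \<partial>period_measure)) \<longlonglongrightarrow> B * sqrt 0"
    by (intro tendsto_intros lim)
  then have "(\<lambda>n. B * sqrt (\<integral>x. (norm (g x - u n x))\<^sup>2 \<partial>period_measure)) \<longlonglongrightarrow> 0"
    by simp
  then have "(\<lambda>n. (\<integral>x. u n x * \<psi> x \<partial>period_measure) - (\<integral>x. g x * \<psi> x \<partial>period_measure)) \<longlonglongrightarrow> 0"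
    by (rule Lim_null_comparison[OF always_eventually[OF allI[OF bound]]])
  then show ?thesis
    by (rule LIM_zero_cancel)
qed

text \<open>Turns limits over the net of finite sets of integers into limits of sequences of
  symmetric partial sums.\<close>

lemma filterlim_symmetric_int_intervals:
  "filterlim (\<lambda>n. {- int n..int n}) (finite_subsets_at_top UNIV) sequentially"
proof (subst filterlim_finite_subsets_at_top, intro allI impI)
  fix X :: "int set" assume X: "finite X \<and> X \<subseteq> UNIV"
  have "\<forall>\<^sub>F n in sequentially. \<forall>k\<in>X. n \<ge> nat \<bar>k\<bar>"
    using X by (intro eventually_ball_finite ballI eventually_ge_at_top) simp
  then show "\<forall>\<^sub>F n in sequentially. finite {- int n..int n} \<and> X \<subseteq> {- int n..int n} \<and> {- int n..int n} \<subseteq> UNIV"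
  proof eventually_elim
    case (elim n)
    then have "- int n \<le> k \<and> k \<le> int n" if "k \<in> X" for k
      using bspec[OF elim that] by linarith
    then show ?case by auto
  qed
qed

text \<open>Choosing the limit function as a pointwise \<^const>\<open>lim\<close> makes it periodic everywhere,
  including on the null set where the partial sums diverge.\<close>

lemma Riesz_Fischer:
  assumes "(\<lambda>k::int. (norm (b k))\<^sup>2) summable_on UNIV"
  obtains g where "g \<in> L2_circle"
    "(\<lambda>n. \<integral>x. (norm (g x - (\<Sum>k\<in>{- int n..int n}. b k * echar k x)))\<^sup>2 \<partial>period_measure) \<longlonglongrightarrow> 0"
proof -
  define S where "S n x = (\<Sum>k\<in>{- int n..int n}. b k * echar k x)" for n x
  define L where "L = (\<Sum>\<^sub>\<infinity>k. (norm (b k))\<^sup>2)"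
  define B where "B n = (\<Sum>k\<in>{- int n..int n}. (norm (b k))\<^sup>2)" for n
  have hs: "((\<lambda>k. (norm (b k))\<^sup>2) has_sum L) UNIV"
    using assms unfolding L_def by (rule has_sum_infsum)
  have B: "B \<longlonglongrightarrow> L"
    using filterlim_compose[OF hs[unfolded has_sum_def] filterlim_symmetric_int_intervals] by (simp add: B_def[abs_def])
  have BL: "B n \<le> L" for n
    unfolding B_def by (rule has_sum_mono_neutral[OF has_sum_finite[of "{- int n..int n}"] hs]) auto
  have contS: "continuous_on UNIV (S n)" for n
    unfolding S_def by (intro continuous_intros)
  have contSS: "continuous_on UNIV (\<lambda>x. S m x - S n x)" for m n
    by (intro continuous_intros contS)
  have diff: "(\<integral>x. (norm (S j x - S i x))\<^sup>2 \<partial>period_measure) = B j - B i" if "i \<le> j" for i j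
  proof -
    have sub: "{- int i..int i} \<subseteq> {- int j..int j}" using that by auto
    have "S j x - S i x = (\<Sum>k\<in>{- int j..int j} - {- int i..int i}. b k * echar k x)" for x
      unfolding S_def by (rule sum_diff[symmetric]) (use sub in auto)
    then have "(\<integral>x. (norm (S j x - S i x))\<^sup>2 \<partial>period_measure)
        = (\<Sum>k\<in>{- int j..int j} - {- int i..int i}. (norm (b k))\<^sup>2)"
      by (simp only: integral_norm_squared_trig_sum finite_Diff finite_atLeastAtMost_int)
    also have "\<dots> = B j - B i"
      unfolding B_def by (rule sum_diff) (use sub in auto)
    finally show ?thesis .
  qed
  \<comment> \<open>The partial sums are Cauchy in \<open>L2\<close>, hence in \<open>L1\<close>,
    and an \<open>L1\<close>-Cauchy sequence has a subsequence that is Cauchy almost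
    everywhere.\<close>
  have "\<exists>N. \<forall>i\<ge>N. \<forall>j\<ge>N. (\<integral>x. norm (S i x - S j x) \<partial>period_measure) < e" if e: "e > 0" for e
  proof -
    obtain N where N: "\<And>n. n \<ge> N \<Longrightarrow> \<bar>B n - L\<bar> < e\<^sup>2"
      using LIMSEQ_D[OF B, of "e\<^sup>2"] e by (metis real_norm_def zero_less_power)
    have *: "(\<integral>x. norm (S j x - S i x) \<partial>period_measure) < e" if "N \<le> i" "i \<le> j" for i j
    proof -
      have "(\<integral>x. norm (S j x - S i x) \<partial>period_measure)\<^sup>2 \<le> B j - B i"
        using integral_norm_squared_le[OF square_integrable_continuous[OF contSS]] diff[OF that(2)] by metis
      also have "\<dots> < e\<^sup>2" using N[OF that(1)] BL[of j] by linarith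
      finally show ?thesis using e power_less_imp_less_base by fastforce
    qed
    have "(\<integral>x. norm (S i x - S j x) \<partial>period_measure) < e" if "N \<le> i" "N \<le> j" for i j
      using *[of i j] *[of j i] that by (cases "i \<le> j") (auto simp: norm_minus_commute)
    then show ?thesis by blast
  qed
  then obtain r where r: "strict_mono r" "AE x in period_measure. Cauchy (\<lambda>i. S (r i) x)"
    using cauchy_L1_AE_cauchy_subseq[of period_measure S] integrable_period_continuous[OF contS] by blast
  define g where "g x = lim (\<lambda>i. S (r i) x)" for x
  have measS: "S n \<in> borel_measurable period_measure" for n
    by (intro measurable_period borel_measurable_continuous_onI contS)
  have measg: "g \<in> borel_measurable period_measure"
    unfolding g_def by (rule borel_measurable_lim_metric) (rule measS)
  have AE: "AE x in period_measure. (\<lambda>i. S (r i) x) \<longlonglongrightarrow> g x"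
    using r(2) by eventually_elim (simp add: g_def Cauchy_convergent_iff convergent_LIMSEQ_iff)
  \<comment> \<open>Fatou's lemma along the subsequence: \<open>S (r i)\<close> tends to
    \<open>g\<close> almost everywhere, while its squared distance from \<open>S n\<close> is
    \<open>B (r i) - B n\<close>, at most \<open>L - B n\<close>.\<close>
  have nn: "(\<integral>\<^sup>+x. ennreal ((norm (g x - S n x))\<^sup>2) \<partial>period_measure) \<le> ennreal (L - B n)" for n
  proof -
    have "(\<integral>\<^sup>+x. ennreal ((norm (g x - S n x))\<^sup>2) \<partial>period_measure)
        = (\<integral>\<^sup>+x. liminf (\<lambda>i. ennreal ((norm (S (r i) x - S n x))\<^sup>2)) \<partial>period_measure)"
    proof (rule nn_integral_cong_AE)
      show "AE x in period_measure. ennreal ((norm (g x - S n x))\<^sup>2)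
          = liminf (\<lambda>i. ennreal ((norm (S (r i) x - S n x))\<^sup>2))"
        using AE
      proof eventually_elim
        case (elim x)
        then have "(\<lambda>i. ennreal ((norm (S (r i) x - S n x))\<^sup>2)) \<longlonglongrightarrow> ennreal ((norm (g x - S n x))\<^sup>2)"
          by (intro tendsto_ennrealI tendsto_intros)
        then show ?case
          by (rule lim_imp_Liminf[OF trivial_limit_sequentially, symmetric])
      qed
    qed
    also have "\<dots> \<le> liminf (\<lambda>i. \<integral>\<^sup>+x. ennreal ((norm (S (r i) x - S n x))\<^sup>2) \<partial>period_measure)"
      by (intro nn_integral_liminf measurable_compose[OF _ measurable_ennreal]
          borel_measurable_power measurable_compose[OF _ borel_measurable_norm] borel_measurable_diff measS)
    also have "\<dots> \<le> liminf (\<lambda>i. ennreal (L - B n))"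
    proof (rule Liminf_mono)
      have "\<forall>\<^sub>F i in sequentially. n \<le> i" by (rule eventually_ge_at_top)
      then show "\<forall>\<^sub>F i in sequentially.
          (\<integral>\<^sup>+x. ennreal ((norm (S (r i) x - S n x))\<^sup>2) \<partial>period_measure) \<le> ennreal (L - B n)"
      proof eventually_elim
        case (elim i)
        then have "n \<le> r i" using seq_suble[OF r(1), of i] by linarith
        moreover have "integrable period_measure (\<lambda>x. (norm (S (r i) x - S n x))\<^sup>2)"
          by (intro integrable_period_continuous continuous_intros contSS)
        ultimately show ?case
          using BL[of "r i"] by (subst nn_integral_eq_integral) (auto simp: diff intro!: ennreal_leI)
      qed
    qed
    finally show ?thesis by (simp add: Liminf_const)
  qed
  have gS: "square_integrable period_measure (\<lambda>x. g x - S n x)" for n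
    unfolding square_integrable_def
  proof (intro conjI integrableI_bounded)
    show "(\<lambda>x. g x - S n x) \<in> borel_measurable period_measure"
      by (intro borel_measurable_diff measg measS)
    then show "(\<lambda>x. (norm (g x - S n x))\<^sup>2) \<in> borel_measurable period_measure"
      by (intro borel_measurable_power measurable_compose[OF _ borel_measurable_norm])
    show "(\<integral>\<^sup>+x. ennreal (norm ((norm (g x - S n x))\<^sup>2)) \<partial>period_measure) < \<infinity>"
      using nn[of n] by (simp add: order_le_less_trans)
  qed
  have le: "(\<integral>x. (norm (g x - S n x))\<^sup>2 \<partial>period_measure) \<le> L - B n" for n
    using nn[of n] BL[of n] nn_integral_eq_integral[OF integrable_norm_sq[OF gS]] by simp
  show thesis
  proof (rule that)
    have "square_integrable period_measure g"
      using square_integrable_add[OF gS[of 0] square_integrable_continuous[OF contS[of 0]]] by simp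
    moreover have "periodic g"
      by (simp add: periodic_def g_def S_def echar_periodic)
    ultimately show "g \<in> L2_circle" by (simp add: L2_circle_def)
    have "(\<lambda>n. \<integral>x. (norm (g x - S n x))\<^sup>2 \<partial>period_measure) \<longlonglongrightarrow> 0"
    proof (rule tendsto_sandwich)
      show "\<forall>\<^sub>F n in sequentially. 0 \<le> (\<integral>x. (norm (g x - S n x))\<^sup>2 \<partial>period_measure)"
        by simp
      show "\<forall>\<^sub>F n in sequentially. (\<integral>x. (norm (g x - S n x))\<^sup>2 \<partial>period_measure) \<le> L - B n"
        using le by simp
      show "(\<lambda>n. L - B n) \<longlonglongrightarrow> 0" using tendsto_diff[OF tendsto_const B, of L] by simp
    qed simp
    then show "(\<lambda>n. \<integral>x. (norm (g x - (\<Sum>k\<in>{- int n..int n}. b k * echar k x)))\<^sup>2 \<partial>period_measure) \<longlonglongrightarrow> 0"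
      by (simp add: S_def)
  qed
qed

section \<open>Absolutely convergent Fourier series\<close>

text \<open>The Weierstrass test gives a continuous sum \<open>F\<close>. Its coefficients are those
  of \<open>f\<close>, so \<open>f - F\<close> is continuous and periodic with all coefficients 0
  and hence vanishes.\<close>

lemma Fourier_series_uniform_limit:
  assumes cont: "continuous_on UNIV f" and per: "periodic f"
    and sum: "(\<lambda>k. norm (fourier_coeff f k)) summable_on UNIV"
  shows "uniform_limit UNIV (\<lambda>n x. \<Sum>k\<in>{- int n..int n}. fourier_coeff f k * echar k x) f sequentially"
proof -
  define F where "F x = (\<Sum>\<^sub>\<infinity>k. fourier_coeff f k * echar k x)" for x
  have lim: "uniform_limit UNIV (\<lambda>K x. \<Sum>k\<in>K. fourier_coeff f k * echar k x) F (finite_subsets_at_top UNIV)"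
    unfolding F_def by (rule Weierstrass_m_test_general[OF _ sum]) (simp add: norm_mult)
  have contF: "continuous_on UNIV F"
    by (rule uniform_limit_theorem[OF _ lim])
       (auto intro!: always_eventually continuous_intros)
  have "fourier_coeff F l = fourier_coeff f l" for l
  proof (rule tendsto_unique)
    show "((\<lambda>K. fourier_coeff (\<lambda>x. \<Sum>k\<in>K. fourier_coeff f k * echar k x) l) \<longlongrightarrow> fourier_coeff F l) (finite_subsets_at_top UNIV)"
      unfolding fourier_coeff_echar[of _ l]
      by (intro tendsto_integral_period_uniform contF uniform_limit_on_subset[OF lim] continuous_intros) auto
    \<comment> \<open>The \<open>l\<close>-th coefficient of a partial sum is already the final one
      as soon as \<open>K\<close> contains \<open>l\<close>.\<close>
    have "\<forall>\<^sub>F K in finite_subsets_at_top UNIV. l \<in> K \<and> finite K"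
      unfolding eventually_finite_subsets_at_top by (rule exI[of _ "{l}"]) auto
    then have "\<forall>\<^sub>F K in finite_subsets_at_top UNIV.
        fourier_coeff (\<lambda>x. \<Sum>k\<in>K. fourier_coeff f k * echar k x) l = fourier_coeff f l"
      by eventually_elim (simp add: fourier_coeff_trig_sum)
    then show "((\<lambda>K. fourier_coeff (\<lambda>x. \<Sum>k\<in>K. fourier_coeff f k * echar k x) l) \<longlongrightarrow> fourier_coeff f l) (finite_subsets_at_top UNIV)"
      by (rule tendsto_eventually)
  qed simp
  moreover have "fourier_coeff (\<lambda>x. f x - F x) l = fourier_coeff f l - fourier_coeff F l" for l
    unfolding fourier_coeff_echar left_diff_distrib
    by (intro Bochner_Integration.integral_diff integrable_period_continuous continuous_intros cont contF)
  moreover have "periodic F"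
    by (simp add: periodic_def F_def echar_periodic)
  ultimately have "f x - F x = 0" for x
    using per by (intro continuous_periodic_eq_0[where f = "\<lambda>x. f x - F x"] continuous_intros cont contF)
      (auto simp: periodic_def)
  then have "f = F" by (simp add: fun_eq_iff)
  with filterlim_compose[OF lim filterlim_symmetric_int_intervals] show ?thesis
    by simp
qed

section \<open>Smooth test functions and integration by parts\<close>

lemma vderiv_echar:
  "(vderiv ^^ n) (\<lambda>x. c * echar k x) = (\<lambda>x. ((2 * of_real pi * \<i> * of_int k) ^ n * c) * echar k x)"
proof (induction n)
  case (Suc n)
  let ?w = "2 * of_real pi * \<i> * of_int k :: complex"
  have "(vderiv ^^ Suc n) (\<lambda>x. c * echar k x) = vderiv (\<lambda>x. (?w ^ n * c) * echar k x)"
    by (simp only: funpow.simps o_def Suc)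
  also have "\<dots> = (\<lambda>x. ?w * (?w ^ n * c) * echar k x)"
    unfolding vderiv_def by (intro ext vector_derivative_at echar_has_vector_derivative)
  finally show ?case by (simp only: power_Suc mult.assoc)
qed simp

lemma smooth_periodic_echar: "smooth_periodic (echar k)"
  unfolding smooth_periodic_def
proof (intro conjI allI)
  show "periodic (echar k)"
    by (simp add: periodic_def echar_periodic)
  fix n x
  have "(vderiv ^^ n) (\<lambda>x. 1 * echar k x) differentiable (at x)"
    unfolding vderiv_echar by (rule differentiableI_vector, rule echar_has_vector_derivative)
  then show "(vderiv ^^ n) (echar k) differentiable (at x)" by simp
qed

lemma smooth_periodic_has_vector_derivative:
  assumes "smooth_periodic \<phi>"
  shows "((vderiv ^^ n) \<phi> has_vector_derivative (vderiv ^^ Suc n) \<phi> x) (at x)"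
  using assms unfolding smooth_periodic_def funpow.simps o_def vderiv_def
  by (simp flip: vector_derivative_works)

lemma smooth_periodic_continuous:
  assumes "smooth_periodic \<phi>"
  shows "continuous_on UNIV \<phi>" and "continuous_on UNIV (vderiv (vderiv \<phi>))"
proof -
  have "continuous_on UNIV ((vderiv ^^ n) \<phi>)" for n
    using smooth_periodic_has_vector_derivative[OF assms] has_vector_derivative_continuous
    by (blast intro: continuous_at_imp_continuous_on)
  from this[of 0] this[of 2] show "continuous_on UNIV \<phi>" "continuous_on UNIV (vderiv (vderiv \<phi>))"
    by (simp_all add: numeral_2_eq_2)
qed

lemma vderiv_periodic:
  assumes "periodic \<phi>" "\<And>x. (\<phi> has_vector_derivative vderiv \<phi> x) (at x)"
  shows "vderiv \<phi> (x + 1) = vderiv \<phi> x"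
proof -
  have "((\<lambda>x. x + 1) has_vector_derivative 1) (at x)"
    by (auto intro!: derivative_eq_intros)
  then have "(\<phi> \<circ> (\<lambda>x. x + 1) has_vector_derivative 1 *\<^sub>R vderiv \<phi> (x + 1)) (at x)"
    by (rule vector_diff_chain_at) (rule assms(2))
  moreover have "\<phi> \<circ> (\<lambda>x. x + 1) = \<phi>"
    using assms(1) by (auto simp: periodic_def)
  ultimately show ?thesis
    using assms(2) by (simp add: vector_derivative_unique_at)
qed

lemma integral_echar_by_parts:
  assumes \<phi>: "smooth_periodic \<phi>"
  shows "(\<integral>x. echar k x * vderiv (vderiv \<phi>) x \<partial>period_measure)
       = (2 * of_real pi * \<i> * of_int k)\<^sup>2 * (\<integral>x. echar k x * \<phi> x \<partial>period_measure)"
proof -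
  let ?w = "2 * of_real pi * \<i> * of_int k :: complex"
  note D = smooth_periodic_has_vector_derivative[OF \<phi>]
  have D0: "(\<phi> has_vector_derivative vderiv \<phi> x) (at x)" for x
    using D[of 0] by simp
  have D1: "(vderiv \<phi> has_vector_derivative vderiv (vderiv \<phi>) x) (at x)" for x
    using D[of 1] by simp
  note c0 = smooth_periodic_continuous(1)[OF \<phi>] and c2 = smooth_periodic_continuous(2)[OF \<phi>]
  have De: "(echar k has_vector_derivative ?w * echar k x) (at x)" for x
    using echar_has_vector_derivative[of 1 k] by simp
  \<comment> \<open>Both integrations by parts are done with one antiderivative: differentiating
    \<open>?F\<close>, the mixed terms containing \<open>vderiv \<phi>\<close> and the factor
    \<open>?w\<close> cancel. Its boundary values agree by periodicity.\<close>
  let ?F = "\<lambda>x. echar k x * vderiv \<phi> x - (?w * echar k x) * \<phi> x"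
  have "(?F has_vector_derivative (echar k x * vderiv (vderiv \<phi>) x - ?w\<^sup>2 * (echar k x * \<phi> x))) (at x)" for x
    using has_vector_derivative_diff[OF has_vector_derivative_mult[OF De D1]
        has_vector_derivative_mult[OF echar_has_vector_derivative[of ?w k] D0], of x]
    by (rule has_vector_derivative_eq_rhs) (simp add: power2_eq_square algebra_simps)
  then have "(\<integral>x. echar k x * vderiv (vderiv \<phi>) x - ?w\<^sup>2 * (echar k x * \<phi> x) \<partial>period_measure) = ?F 1 - ?F 0"
    by (rule integral_period_FTC) (intro continuous_intros c0 c2)
  also have "\<dots> = 0"
    using \<phi> vderiv_periodic[OF _ D0, of 0] echar_periodic[of k 0]
    by (simp add: smooth_periodic_def periodic_def) (metis add_0)
  finally have "(\<integral>x. echar k x * vderiv (vderiv \<phi>) x - ?w\<^sup>2 * (echar k x * \<phi> x) \<partial>period_measure) = 0" .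
  moreover have "integrable period_measure (\<lambda>x. echar k x * vderiv (vderiv \<phi>) x)"
    "integrable period_measure (\<lambda>x. ?w\<^sup>2 * (echar k x * \<phi> x))"
    by (intro integrable_period_continuous continuous_intros c0 c2)+
  ultimately show ?thesis by simp
qed

section \<open>Coefficient decay and the weak second derivative\<close>

text \<open>The term at \<open>k = 0\<close> is \<open>1 / 0 = 0\<close>, so the sum may range over
  all integers, covered by the images of \<open>int\<close> and its negative.\<close>

lemma summable_on_inverse_square_int: "(\<lambda>k::int. 1 / (real_of_int k)\<^sup>2) summable_on UNIV"
proof -
  have "summable (\<lambda>n. norm (1 / (real n)\<^sup>2))"
    using inverse_power_summable[of 2] by (simp add: field_simps)
  then have s: "(\<lambda>n. 1 / (real n)\<^sup>2) summable_on UNIV"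
    by (rule norm_summable_imp_summable_on)
  have "(\<lambda>k. 1 / (real_of_int k)\<^sup>2) summable_on range int"
    using s by (subst summable_on_reindex) (auto simp: o_def inj_on_def)
  moreover have "(\<lambda>k. 1 / (real_of_int k)\<^sup>2) summable_on range (\<lambda>n. - int n)"
    using s by (subst summable_on_reindex) (auto simp: o_def inj_on_def)
  moreover have "UNIV = range int \<union> range (\<lambda>n. - int n)"
  proof -
    have "k \<in> range int \<union> range (\<lambda>n. - int n)" for k by (cases k rule: int_cases2) auto
    then show ?thesis by blast
  qed
  ultimately show ?thesis
    by (metis summable_on_union)
qed

lemma summable_on_fourier_coeff:
  assumes "has_second_deriv_in_L2 f"
  shows "(\<lambda>k. norm (fourier_coeff f k)) summable_on UNIV"
proof (rule summable_on_comparison_test)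
  let ?c = "fourier_coeff f"
  \<comment> \<open>At \<open>k = 0\<close> the factor \<open>(of_int k)\<^sup>2\<close> erases the
    coefficient, so it gets a term of its own. Elsewhere \<open>norm (?c k)\<close> is split as
    \<open>s * t\<close> with \<open>s\<close> the inverse square of \<open>k\<close>, and
    \<open>s * t \<le> s + t\<^sup>2\<close> as \<open>s \<le> 1\<close>.\<close>
  let ?h = "\<lambda>k. (if k = 0 then norm (?c 0) else 0) + (1 / (real_of_int k)\<^sup>2 + (norm ((of_int k)\<^sup>2 * ?c k))\<^sup>2)"
  have "(\<lambda>k::int. if k = 0 then norm (?c 0) else 0) summable_on UNIV"
    by (rule finite_nonzero_values_imp_summable_on) simp
  then show "?h summable_on UNIV"
    using assms unfolding has_second_deriv_in_L2_def
    by (intro summable_on_add summable_on_inverse_square_int)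
  fix k :: int
  show "norm (?c k) \<le> ?h k"
  proof (cases "k = 0")
    case False
    then have "1 \<le> \<bar>real_of_int k\<bar>" by linarith
    then have k: "1 \<le> (real_of_int k)\<^sup>2"
      using power_mono[of 1 "\<bar>real_of_int k\<bar>" 2] by simp
    define s t where "s = 1 / (real_of_int k)\<^sup>2" and "t = (real_of_int k)\<^sup>2 * norm (?c k)"
    have "norm (?c k) = s * t" using False by (simp add: s_def t_def)
    also have "s * t \<le> s + t\<^sup>2"
    proof -
      have "0 \<le> s" "s \<le> 1" using k by (auto simp: s_def divide_le_eq_1)
      then have "s\<^sup>2 \<le> s" by (simp add: power2_eq_square mult_left_le)
      moreover have "0 \<le> s * t" using \<open>0 \<le> s\<close> by (simp add: t_def)
      ultimately show ?thesis using sum_squares_bound[of s t] by linarith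
    qed
    finally show ?thesis using False by (simp add: s_def t_def norm_mult norm_power)
  qed simp
qed simp

text \<open>Take for \<open>g\<close> the \<open>L2\<close> sum of the series differentiated
  termwise. For partial sums the defining identity is integration by parts; then the left side
  passes to the limit by uniform convergence and the right side by \<open>L2\<close>
  convergence.\<close>

lemma weak_second_deriv_exists:
  assumes cont: "continuous_on UNIV f" and per: "periodic f" and f2: "has_second_deriv_in_L2 f"
  shows "\<exists>g. g \<in> L2_circle \<and> is_weak_second_deriv f g"
proof -
  define w where "w k = (2 * of_real pi * \<i> * of_int k :: complex)" for k :: int
  define b where "b k = (w k)\<^sup>2 * fourier_coeff f k" for k
  have "(\<lambda>k. (4 * pi\<^sup>2)\<^sup>2 * (norm ((of_int k)\<^sup>2 * fourier_coeff f k))\<^sup>2) summable_on UNIV"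
    using f2 unfolding has_second_deriv_in_L2_def by (rule summable_on_cmult_right)
  then have "(\<lambda>k. (norm (b k))\<^sup>2) summable_on UNIV"
    by (simp add: b_def w_def norm_mult norm_power power_mult_distrib mult.assoc)
  then obtain g where g: "g \<in> L2_circle" and
    lim: "(\<lambda>n. \<integral>x. (norm (g x - (\<Sum>k\<in>{- int n..int n}. b k * echar k x)))\<^sup>2 \<partial>period_measure) \<longlonglongrightarrow> 0"
    using Riesz_Fischer by blast
  have "(\<integral>x. f x * vderiv (vderiv \<phi>) x \<partial>period_measure) = (\<integral>x. g x * \<phi> x \<partial>period_measure)"
    if \<phi>: "smooth_periodic \<phi>" for \<phi>
  proof (rule LIMSEQ_unique)
    note c0 = smooth_periodic_continuous(1)[OF \<phi>] and c2 = smooth_periodic_continuous(2)[OF \<phi>]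
    let ?S = "\<lambda>n x. \<Sum>k\<in>{- int n..int n}. fourier_coeff f k * echar k x"
    let ?T = "\<lambda>n x. \<Sum>k\<in>{- int n..int n}. b k * echar k x"
    show "(\<lambda>n. \<integral>x. ?S n x * vderiv (vderiv \<phi>) x \<partial>period_measure)
        \<longlonglongrightarrow> (\<integral>x. f x * vderiv (vderiv \<phi>) x \<partial>period_measure)"
      by (rule tendsto_integral_period_uniform[OF uniform_limit_on_subset[OF
            Fourier_series_uniform_limit[OF cont per summable_on_fourier_coeff[OF f2]]]])
        (auto intro!: continuous_intros cont c2)
    have "(\<integral>x. ?S n x * vderiv (vderiv \<phi>) x \<partial>period_measure) = (\<integral>x. ?T n x * \<phi> x \<partial>period_measure)" for n
    proof -
      have I: "(\<integral>x. (\<Sum>k\<in>K. c k * echar k x) * \<psi> x \<partial>period_measure)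
          = (\<Sum>k\<in>K. c k * (\<integral>x. echar k x * \<psi> x \<partial>period_measure))"
        if "continuous_on UNIV \<psi>" for c \<psi> and K :: "int set"
      proof -
        have "integrable period_measure (\<lambda>x. c k * (echar k x * \<psi> x))" for k
          by (intro integrable_period_continuous continuous_intros that)
        then show ?thesis by (simp add: sum_distrib_right mult.assoc)
      qed
      show ?thesis
        unfolding I[OF c0] I[OF c2] integral_echar_by_parts[OF \<phi>] b_def w_def by (simp add: mult_ac)
    qed
    then show "(\<lambda>n. \<integral>x. ?S n x * vderiv (vderiv \<phi>) x \<partial>period_measure)
        \<longlonglongrightarrow> (\<integral>x. g x * \<phi> x \<partial>period_measure)"
      using tendsto_integral_period_L2[OF lim, of \<phi>] g c0
      by (simp add: L2_circle_def continuous_intros)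
  qed
  then show ?thesis
    using g unfolding is_weak_second_deriv_def by blast
qed

text \<open>Test against \<open>echar (- k)\<close>, an eigenfunction of the second
  derivative.\<close>

lemma weak_second_deriv_fourier_coeff:
  assumes "is_weak_second_deriv f g"
  shows "fourier_coeff g k = (2 * of_real pi * \<i> * of_int k)\<^sup>2 * fourier_coeff f k"
proof -
  define d where "d = (2 * of_real pi * \<i> * of_int k :: complex)\<^sup>2"
  have "vderiv (vderiv (echar (- k))) = (\<lambda>x. d * echar (- k) x)"
    using vderiv_echar[of 2 1 "- k"] by (simp add: numeral_2_eq_2 d_def)
  then have "(\<integral>x. f x * (d * echar (- k) x) \<partial>period_measure) = (\<integral>x. g x * echar (- k) x \<partial>period_measure)"
    using assms smooth_periodic_echar unfolding is_weak_second_deriv_def by metis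
  then show ?thesis
    unfolding d_def[symmetric] by (simp add: fourier_coeff_echar mult.left_commute[of _ d])
qed

lemma norm_diff_le_weak_second_deriv:
  assumes cont: "continuous_on UNIV f" and per: "periodic f" and f2: "has_second_deriv_in_L2 f"
  shows "norm (f x - f 0)
    \<le> sqrt (\<Sum>\<^sub>\<infinity>k::int. 1 / (real_of_int k)\<^sup>2) * \<bar>x\<bar> * L2_norm period_measure (weak_second_deriv f)"
proof -
  define g where "g = weak_second_deriv f"
  define Z where "Z = (\<Sum>\<^sub>\<infinity>k::int. 1 / (real_of_int k)\<^sup>2)"
  \<comment> \<open>Existence makes the choice behind \<open>weak_second_deriv\<close> a genuine
    one; the estimate uses only these two properties of \<open>g\<close>.\<close>
  have "g \<in> L2_circle \<and> is_weak_second_deriv f g"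
    unfolding g_def weak_second_deriv_def by (rule someI_ex[OF weak_second_deriv_exists[OF assms]])
  then have g: "square_integrable period_measure g" "is_weak_second_deriv f g"
    by (simp_all add: L2_circle_def)
  let ?c = "fourier_coeff f"
  let ?S = "\<lambda>n x. \<Sum>k\<in>{- int n..int n}. ?c k * echar k x"
  have bound: "norm (?S n x - ?S n 0) \<le> sqrt Z * \<bar>x\<bar> * L2_norm period_measure g" for n
  proof -
    let ?K = "{- int n..int n}"
    \<comment> \<open>For nonzero \<open>k\<close> the right side is exactly \<open>2 * pi\<close>
      times the left, and this factor is given away. At \<open>k = 0\<close> both sides are 0, again
      by \<open>1 / 0 = 0\<close>.\<close>
    have coeff: "norm (?c k) * (2 * pi * \<bar>real_of_int k\<bar>) \<le> norm (fourier_coeff g k) * (1 / \<bar>real_of_int k\<bar>)" for k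
    proof (cases "k = 0")
      case False
      have "norm (fourier_coeff g k) * (1 / \<bar>real_of_int k\<bar>) = (2 * pi) * (norm (?c k) * (2 * pi * \<bar>real_of_int k\<bar>))"
        using False unfolding weak_second_deriv_fourier_coeff[OF g(2)]
        by (simp add: norm_mult norm_power power2_eq_square field_simps)
      moreover have "1 \<le> 2 * pi" using pi_ge_two by simp
      ultimately show ?thesis
        using mult_right_mono[of 1 "2 * pi" "norm (?c k) * (2 * pi * \<bar>real_of_int k\<bar>)"] by simp
    qed simp
    have "norm (?S n x - ?S n 0) = norm (\<Sum>k\<in>?K. ?c k * (echar k x - 1))"
      by (simp add: sum_subtractf[symmetric] right_diff_distrib)
    also have "\<dots> \<le> (\<Sum>k\<in>?K. (norm (fourier_coeff g k) * (1 / \<bar>real_of_int k\<bar>)) * \<bar>x\<bar>)"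
    proof (rule sum_norm_le)
      fix k
      have "norm (?c k * (echar k x - 1)) \<le> norm (?c k) * (2 * pi * \<bar>real_of_int k\<bar> * \<bar>x\<bar>)"
        unfolding norm_mult by (intro mult_left_mono norm_echar_diff_le norm_ge_zero)
      also have "\<dots> \<le> (norm (fourier_coeff g k) * (1 / \<bar>real_of_int k\<bar>)) * \<bar>x\<bar>"
        using mult_right_mono[OF coeff[of k] abs_ge_zero[of x]] by (simp add: mult_ac)
      finally show "norm (?c k * (echar k x - 1)) \<le> (norm (fourier_coeff g k) * (1 / \<bar>real_of_int k\<bar>)) * \<bar>x\<bar>" .
    qed
    also have "\<dots> = (\<Sum>k\<in>?K. norm (fourier_coeff g k) * (1 / \<bar>real_of_int k\<bar>)) * \<bar>x\<bar>"
      by (simp add: sum_distrib_right)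
    also have "(\<Sum>k\<in>?K. norm (fourier_coeff g k) * (1 / \<bar>real_of_int k\<bar>))
        \<le> sqrt ((\<Sum>k\<in>?K. (norm (fourier_coeff g k))\<^sup>2) * (\<Sum>k\<in>?K. (1 / \<bar>real_of_int k\<bar>)\<^sup>2))"
      by (rule real_le_rsqrt) (rule Cauchy_Schwarz_ineq_sum)
    also have "\<dots> \<le> sqrt ((\<integral>x. (norm (g x))\<^sup>2 \<partial>period_measure) * Z)"
    proof (intro real_sqrt_le_mono mult_mono)
      show "(\<Sum>k\<in>?K. (norm (fourier_coeff g k))\<^sup>2) \<le> (\<integral>x. (norm (g x))\<^sup>2 \<partial>period_measure)"
        by (rule Bessel_inequality[OF g(1)]) simp
      have "(\<Sum>k\<in>?K. 1 / (real_of_int k)\<^sup>2) \<le> Z"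
        unfolding Z_def by (rule finite_sum_le_infsum[OF summable_on_inverse_square_int]) auto
      then show "(\<Sum>k\<in>?K. (1 / \<bar>real_of_int k\<bar>)\<^sup>2) \<le> Z" by (simp add: power_divide)
    qed (auto intro: sum_nonneg)
    also have "\<dots> = sqrt Z * L2_norm period_measure g"
      by (simp add: L2_norm_def real_sqrt_mult)
    finally show ?thesis by (simp add: mult_ac mult_right_mono)
  qed
  have lim: "(\<lambda>n. ?S n y) \<longlonglongrightarrow> f y" for y
    using tendsto_uniform_limitI[OF Fourier_series_uniform_limit[OF cont per summable_on_fourier_coeff[OF f2]]] by simp
  have "(\<lambda>n. norm (?S n x - ?S n 0)) \<longlonglongrightarrow> norm (f x - f 0)"
    by (intro tendsto_norm tendsto_diff lim)
  then show ?thesis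
    unfolding Z_def[symmetric] g_def[symmetric]
    by (rule LIMSEQ_le_const2) (use bound in blast)
qed

subsection \<open>Infinite products\<close>

text \<open>Uniform convergence of the sums of \<open>norm (f n x - 1)\<close> gives a uniform limit
  \<open>l\<close> of the partial products. Absolute convergence at each point yields
  \<open>has_prod\<close>, which tolerates finitely many zero factors and identifies
  \<open>l\<close> with the infinite product.\<close>

lemma Weierstrass_product_test:
  fixes f :: "nat \<Rightarrow> real \<Rightarrow> complex"
  assumes cont: "\<And>n. continuous_on A (f n)" and A: "compact A"
    and bound: "\<And>n x. x \<in> A \<Longrightarrow> norm (f n x - 1) \<le> M n" and M: "summable M"
  shows "uniform_limit A (\<lambda>n x. \<Prod>k<n. f k x) (\<lambda>x. \<Prod>k. f k x) sequentially"
    and "\<And>x. x \<in> A \<Longrightarrow> summable (\<lambda>n. norm (f n x - 1))"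
    and "\<And>x. x \<in> A \<Longrightarrow> (\<lambda>n. f n x) has_prod (\<Prod>k. f k x)"
proof -
  show sum: "summable (\<lambda>n. norm (f n x - 1))" if "x \<in> A" for x
    using bound[OF that] by (intro summable_comparison_test'[OF M]) simp
  show prod: "(\<lambda>n. f n x) has_prod (\<Prod>k. f k x)" if "x \<in> A" for x
    using sum[OF that] by (intro convergent_prod_has_prod abs_convergent_prod_imp_convergent_prod
        summable_imp_abs_convergent_prod)
  have "uniformly_convergent_on A (\<lambda>N x. \<Sum>n<N. norm (f n x - 1))"
    using bound by (intro Weierstrass_m_test'[OF _ M]) simp
  then have "uniformly_convergent_on A (\<lambda>N x. \<Prod>n<N. f n x)"
    by (rule Infinite_Products.uniformly_convergent_on_prod'[OF cont A])
  then obtain l where l: "uniform_limit A (\<lambda>N x. \<Prod>n<N. f n x) l sequentially"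
    unfolding uniformly_convergent_on_def by blast
  have "l x = (\<Prod>k. f k x)" if "x \<in> A" for x
    using LIMSEQ_unique[OF tendsto_uniform_limitI[OF l that] has_prod_imp_tendsto'[OF prod[OF that]]] .
  with l show "uniform_limit A (\<lambda>n x. \<Prod>k<n. f k x) (\<lambda>x. \<Prod>k. f k x) sequentially"
    by (simp cong: uniform_limit_cong')
qed

subsection \<open>The quadrature mirror condition\<close>

lemma integral_shift_real:
  fixes f :: "real \<Rightarrow> real"
  shows "integral {s..t} (\<lambda>x. f (x + c)) = integral {s + c..t + c} f"
  using integral_shift_cbox_plus[of s t f c] by (simp add: o_def add.commute)

lemma integral_fold_interval:
  fixes f :: "real \<Rightarrow> real"
  assumes "continuous_on UNIV f" "0 \<le> d"
  shows "integral {s..s + 2 * d} f = integral {s..s + d} (\<lambda>x. f x + f (x + d))"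
proof -
  have i: "h integrable_on {u..v}" if "continuous_on UNIV h" for h :: "real \<Rightarrow> real" and u v
    by (rule integrable_continuous_interval[OF continuous_on_subset[OF that subset_UNIV]])
  have "integral {s..s + 2 * d} f = integral {s..s + d} f + integral {s + d..s + 2 * d} f"
    using assms by (intro Henstock_Kurzweil_Integration.integral_combine[symmetric] i) auto
  also have "integral {s + d..s + 2 * d} f = integral {s..s + d} (\<lambda>x. f (x + d))"
    by (simp add: integral_shift_real add.commute add.left_commute)
  also have "integral {s..s + d} f + \<dots> = integral {s..s + d} (\<lambda>x. f x + f (x + d))"
    by (intro Henstock_Kurzweil_Integration.integral_add[symmetric] i continuous_on_compose2[OF assms(1)]
        continuous_intros assms) auto
  finally show ?thesis .
qed

text \<open>The norm bound involves squared moduli only, so real functions suffice: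
  \<open>m r\<close> will be the squared modulus of \<open>a (j + r)\<close>.\<close>

locale qmf_products =
  fixes m :: "nat \<Rightarrow> real \<Rightarrow> real"
  assumes cont: "\<And>r. continuous_on UNIV (m r)"
    and per: "\<And>r x. m r (x + 1) = m r x"
    and qmf: "\<And>r x. m r x + m r (x + 1 / 2) = 1"
begin

definition P :: "nat \<Rightarrow> real \<Rightarrow> real" where
  "P n x = (\<Prod>r = 1..n. m r (x / 2 ^ r))"

lemma cont_P: "continuous_on UNIV (P n)"
  unfolding P_def by (intro continuous_intros continuous_on_compose2[OF cont]) auto

lemma per_nat: "m r (x + real k) = m r x"
proof (induction k)
  case (Suc k)
  then show ?case using per[of r "x + real k"] by (simp add: add_ac)
qed simp

text \<open>For \<open>r \<le> n\<close> the shift moves \<open>x / 2 ^ r\<close> by the integer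
  \<open>2 ^ (n - r)\<close>.\<close>

lemma P_periodic: "P n (x + 2 ^ n) = P n x"
  unfolding P_def
proof (rule prod.cong)
  fix r assume "r \<in> {1..n}"
  then have "(2::real) ^ n = 2 ^ r * real (2 ^ (n - r))" by (simp flip: power_add)
  then have "(x + 2 ^ n) / 2 ^ r = x / 2 ^ r + real (2 ^ (n - r))" by (simp add: field_simps)
  then show "m r ((x + 2 ^ n) / 2 ^ r) = m r (x / 2 ^ r)" by (simp only: per_nat)
qed simp

text \<open>The shift by \<open>2 ^ n\<close> fixes the first \<open>n\<close> factors and moves the
  argument of the last one by \<open>1 / 2\<close>, so the mirror condition sums the two last
  factors to 1.\<close>

lemma P_fold: "P (Suc n) x + P (Suc n) (x + 2 ^ n) = P n x"
proof -
  have "P (Suc n) y = P n y * m (Suc n) (y / 2 ^ Suc n)" for y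
    by (simp add: P_def prod.nat_ivl_Suc')
  moreover have "(x + 2 ^ n) / 2 ^ Suc n = x / 2 ^ Suc n + 1 / 2"
    by (simp add: field_simps)
  ultimately show ?thesis
    using qmf[of "Suc n" "x / 2 ^ Suc n"] by (simp only: P_periodic flip: distrib_left)
qed

lemma integral_P: "integral {0..2 ^ n} (P n) = 1"
proof (induction n)
  case 0
  show ?case by (simp add: P_def)
next
  case (Suc n)
  then show ?case
    using integral_fold_interval[OF cont_P, of "2 ^ n" 0 "Suc n"] by (simp only: P_fold) simp
qed

text \<open>Folding at 0 leaves the integral of \<open>P n\<close> over
  \<open>{- (2 ^ n)..0}\<close>, one full period, which a shift carries to
  \<open>{0..2 ^ n}\<close>.\<close>

lemma integral_P_symmetric: "integral {- (2 ^ n)..2 ^ n} (P (Suc n)) = 1"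
proof -
  have "integral {- (2 ^ n)..2 ^ n} (P (Suc n)) = integral {- (2 ^ n)..0} (P n)"
    using integral_fold_interval[OF cont_P, of "2 ^ n" "- (2 ^ n)" "Suc n"] by (simp only: P_fold) simp
  also have "\<dots> = integral {- (2 ^ n)..0} (\<lambda>x. P n (x + 2 ^ n))"
    by (simp only: P_periodic)
  also have "\<dots> = 1"
    by (simp add: integral_shift_real integral_P)
  finally show ?thesis .
qed

text \<open>Truncating \<open>P (Suc n)\<close> to one full period, centred at the origin so that the
  truncations exhaust the real line, makes Fatou's lemma applicable.\<close>

lemma nn_integral_limit_le:
  assumes nonneg: "\<And>r x. 0 \<le> m r x" and lim: "\<And>x. (\<lambda>n. P n x) \<longlonglongrightarrow> p x"
  shows "(\<integral>\<^sup>+x. ennreal (p x) \<partial>lborel) \<le> 1"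
proof -
  let ?u = "\<lambda>n x. ennreal (P (Suc n) x) * indicator {- (2 ^ n)..2 ^ n} x"
  have u: "(\<integral>\<^sup>+x. ?u n x \<partial>lborel) = 1" for n
  proof -
    have "(P (Suc n) has_integral 1) {- (2 ^ n)..2 ^ n}"
      using integrable_integral[OF integrable_continuous_interval[OF continuous_on_subset[OF cont_P subset_UNIV]]]
        integral_P_symmetric by metis
    then show ?thesis
      using nn_integral_has_integral_lebesgue'[of "{- (2 ^ n)..2 ^ n}" "P (Suc n)" 1]
      by (simp add: P_def prod_nonneg nonneg)
  qed
  have "(\<lambda>n. ?u n x) \<longlonglongrightarrow> ennreal (p x)" for x
  proof -
    \<comment> \<open>From index \<open>N\<close> on the truncation no longer affects the point
      \<open>x\<close>.\<close>
    obtain N where N: "\<bar>x\<bar> < 2 ^ N"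
      using real_arch_pow[of 2 "\<bar>x\<bar>"] by auto
    have "?u n x = ennreal (P (Suc n) x)" if "n \<ge> N" for n
    proof -
      have "\<bar>x\<bar> \<le> 2 ^ n" using N power_increasing[OF that, of "2::real"] by linarith
      then show ?thesis by (simp add: abs_le_iff indicator_def)
    qed
    then have "\<forall>\<^sub>F n in sequentially. ennreal (P (Suc n) x) = ?u n x"
      unfolding eventually_sequentially by metis
    moreover have "(\<lambda>n. ennreal (P (Suc n) x)) \<longlonglongrightarrow> ennreal (p x)"
      by (intro tendsto_ennrealI LIMSEQ_Suc lim)
    ultimately show ?thesis
      by (rule Lim_transform_eventually[rotated])
  qed
  then have "(\<integral>\<^sup>+x. ennreal (p x) \<partial>lborel) = (\<integral>\<^sup>+x. liminf (\<lambda>n. ?u n x) \<partial>lborel)"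
    by (intro nn_integral_cong) (metis lim_imp_Liminf trivial_limit_sequentially)
  also have "\<dots> \<le> liminf (\<lambda>n. \<integral>\<^sup>+x. ?u n x \<partial>lborel)"
  proof (rule nn_integral_liminf)
    have [measurable]: "P n \<in> borel_measurable borel" for n
      by (rule borel_measurable_continuous_onI[OF cont_P])
    show "?u n \<in> borel_measurable lborel" for n
      by measurable
  qed
  finally show ?thesis by (simp add: u Liminf_const)
qed

end

section \<open>Convergence of the product and the norm bound\<close>

theorem lemma2:
  fixes a :: "nat \<Rightarrow> real \<Rightarrow> complex"
  assumes "\<And>j. a j \<in> L2_circle"
    and "\<And>j. continuous_on UNIV (a j)"
    and "\<And>j. has_second_deriv_in_L2 (a j)"
    and "\<And>j. a j 0 = 1"
    and "summable (\<lambda>j. L2_norm period_measure (weak_second_deriv (a j)) / 2 ^ j)"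
  shows "(\<forall>j \<alpha> \<beta>.
            uniform_limit {\<alpha>..\<beta>} (\<lambda>n \<xi>. \<Prod>r=1..n. factor a j r \<xi>) (phi_hat a j) sequentially \<and>
            (\<forall>\<xi>\<in>{\<alpha>..\<beta>}. (\<lambda>r. factor a j (Suc r) \<xi>) has_prod phi_hat a j \<xi> \<and>
                         summable (\<lambda>r. norm (factor a j (Suc r) \<xi> - 1)))) \<and>
         ((\<forall>j \<xi>. (norm (a j \<xi>))\<^sup>2 + (norm (a j (\<xi> + 1 / 2)))\<^sup>2 = 1) \<longrightarrow>
            (\<forall>j. square_integrable lborel (phi_hat a j) \<and> L2_norm lborel (phi_hat a j) \<le> 1))"
proof (intro conjI impI)
  define A where "A j = L2_norm period_measure (weak_second_deriv (a j))" for j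
  define C where "C = sqrt (\<Sum>\<^sub>\<infinity>k::int. 1 / (real_of_int k)\<^sup>2)"
  have per: "periodic (a j)" for j
    using assms(1)[of j] by (simp add: L2_circle_def)
  have A0: "0 \<le> A j" for j by (simp add: A_def L2_norm_def)
  have C0: "0 \<le> C" by (auto simp: C_def intro!: infsum_nonneg)
  have lip: "norm (a j x - 1) \<le> C * \<bar>x\<bar> * A j" for j x
    using norm_diff_le_weak_second_deriv[OF assms(2) per assms(3), of j x] assms(4)[of j]
    by (simp add: A_def C_def)
  have cont_factor: "continuous_on S (factor a j r)" for S j r
    unfolding factor_def[abs_def]
    by (intro continuous_on_compose2[OF assms(2)] continuous_intros) auto
  have prod_shift: "(\<Prod>r=1..n. factor a j r \<xi>) = (\<Prod>r<n. factor a j (Suc r) \<xi>)" for n j \<xi>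
    by (simp add: prod.atLeast1_atMost_eq)
  have conv: "uniform_limit {\<alpha>..\<beta>} (\<lambda>n \<xi>. \<Prod>r=1..n. factor a j r \<xi>) (phi_hat a j) sequentially \<and>
            (\<forall>\<xi>\<in>{\<alpha>..\<beta>}. (\<lambda>r. factor a j (Suc r) \<xi>) has_prod phi_hat a j \<xi> \<and>
                         summable (\<lambda>r. norm (factor a j (Suc r) \<xi> - 1)))" for j \<alpha> \<beta>
  proof -
    define R where "R = max \<bar>\<alpha>\<bar> \<bar>\<beta>\<bar>"
    \<comment> \<open>Since \<open>1 / 2 ^ Suc r = 2 ^ j / 2 ^ (r + Suc j)\<close>, the factor
      \<open>2 ^ j\<close> matches the weights of the assumed series, and \<open>M\<close> is a
      multiple of a tail of it.\<close>
    define M where "M r = C * R * 2 ^ j * (A (r + Suc j) / 2 ^ (r + Suc j))" for r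
    have "summable (\<lambda>r. A (r + Suc j) / 2 ^ (r + Suc j))"
      using assms(5) unfolding A_def[symmetric] by (rule summable_ignore_initial_segment)
    then have M: "summable M"
      unfolding M_def by (rule summable_mult)
    have bound: "norm (factor a j (Suc r) \<xi> - 1) \<le> M r" if "\<xi> \<in> {\<alpha>..\<beta>}" for r \<xi>
    proof -
      have "norm (factor a j (Suc r) \<xi> - 1) \<le> C * \<bar>\<xi> / 2 ^ Suc r\<bar> * A (j + Suc r)"
        unfolding factor_def by (rule lip)
      also have "\<dots> \<le> C * (R / 2 ^ Suc r) * A (j + Suc r)"
        using that C0 A0 unfolding R_def
        by (intro mult_right_mono mult_left_mono) (auto simp: abs_divide intro!: divide_right_mono)
      also have "\<dots> = M r"
        by (simp add: M_def power_add add_ac)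
      finally show ?thesis .
    qed
    note W = Weierstrass_product_test[of "{\<alpha>..\<beta>}" "\<lambda>r. factor a j (Suc r)" M,
        OF cont_factor compact_Icc bound M]
    show ?thesis
      using W unfolding prod_shift phi_hat_def[abs_def] by blast
  qed
  then show "\<forall>j \<alpha> \<beta>.
            uniform_limit {\<alpha>..\<beta>} (\<lambda>n \<xi>. \<Prod>r=1..n. factor a j r \<xi>) (phi_hat a j) sequentially \<and>
            (\<forall>\<xi>\<in>{\<alpha>..\<beta>}. (\<lambda>r. factor a j (Suc r) \<xi>) has_prod phi_hat a j \<xi> \<and>
                         summable (\<lambda>r. norm (factor a j (Suc r) \<xi> - 1)))"
    by blast
  \<comment> \<open>Pointwise convergence is the case of a one-point interval.\<close>
  have lim: "(\<lambda>n. \<Prod>r=1..n. factor a j r \<xi>) \<longlonglongrightarrow> phi_hat a j \<xi>" for j \<xi>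
    using conv[where \<alpha> = \<xi> and \<beta> = \<xi> and j = j] by (auto intro: tendsto_uniform_limitI)
  assume qmf: "\<forall>j \<xi>. (norm (a j \<xi>))\<^sup>2 + (norm (a j (\<xi> + 1 / 2)))\<^sup>2 = 1"
  show "\<forall>j. square_integrable lborel (phi_hat a j) \<and> L2_norm lborel (phi_hat a j) \<le> 1"
  proof
    fix j
    interpret qmf_products "\<lambda>r x. (norm (a (j + r) x))\<^sup>2"
      using per qmf assms(2) by unfold_locales (auto simp: periodic_def intro!: continuous_intros)
    have P: "P n \<xi> = (norm (\<Prod>r=1..n. factor a j r \<xi>))\<^sup>2" for n \<xi>
      by (simp add: P_def factor_def prod_power_distrib flip: prod_norm)
    have nn: "(\<integral>\<^sup>+\<xi>. ennreal ((norm (phi_hat a j \<xi>))\<^sup>2) \<partial>lborel) \<le> 1"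
      unfolding P[abs_def] by (rule nn_integral_limit_le) (simp, unfold P, intro tendsto_intros lim)
    have [measurable]: "phi_hat a j \<in> borel_measurable borel"
      by (rule borel_measurable_LIMSEQ_metric[OF _ lim])
         (intro borel_measurable_continuous_onI continuous_intros cont_factor)
    have int: "integrable lborel (\<lambda>\<xi>. (norm (phi_hat a j \<xi>))\<^sup>2)"
      using nn by (intro integrableI_bounded) (auto simp: order_le_less_trans)
    have "ennreal (\<integral>\<xi>. (norm (phi_hat a j \<xi>))\<^sup>2 \<partial>lborel) \<le> ennreal 1"
      using nn by (simp add: nn_integral_eq_integral[OF int, symmetric])
    then have "(\<integral>\<xi>. (norm (phi_hat a j \<xi>))\<^sup>2 \<partial>lborel) \<le> 1"
      by simp
    with int show "square_integrable lborel (phi_hat a j) \<and> L2_norm lborel (phi_hat a j) \<le> 1"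
      by (simp add: square_integrable_def L2_norm_def)
  qed
qed

end
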